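(* Consider the problem $\min_{\theta\in\mathcal C}F(\theta)$ with $F=\frac1N\sum_{i=1}^N f_i$, and run the decentralized Frank-Wolfe (DeFW) iteration described in the context with step size $\gamma_t=2/(t+1)$, $t\ge 1$. Suppose each $f_i$ is convex and $L$-smooth. Let $C_p,C_g$ be two positive constants and suppose that for all $t\ge1$ $$\max_{i\in[N]}\|\bar\theta_t^i-\bar\theta_t\|_2\le \frac{C_p}{t},\qquad \max_{i\in[N]}\|\overline{\nabla_t^iF}-\overline{\nabla_tF}\|_2\le\frac{C_g}{t}.$$ Then for all $t\ge1$ $$F(\bar\theta_t)-F(\theta^\star)\le\frac{8\bar\rho(C_g+LC_p)+2L\bar\rho^2}{t+1},$$ where $\theta^\star$ is an optimal solution of $\min_{\theta\in\mathcal C}F(\theta)$. Furthermore, if $F$ is $\mu$-strongly convex (with $\mu>0$) and the optimal solution $\theta^\star$ lies in the interior of $\mathcal C$, i.e. $\delta>0$, then for all $t\ge1$ $$F(\bar\theta_t)-F(\theta^\star)\le\frac{\big(4\bar\rho(C_g+LC_p)+L\bar\rho^2\big)^2}{2\delta^2\mu}\cdot\frac{9}{(t+1)^2}.$$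
   Context: Setting. $E$ is a Euclidean space (embedded in $\mathbb R^d$) with inner product $\langle\cdot,\cdot\rangle$ and Euclidean norm $\|\cdot\|_2$. $N\ge1$, $[N]=\{1,\dots,N\}$. $\mathcal C\subseteq E$ is a closed bounded convex set, and $f_1,\dots,f_N$ are continuously differentiable real-valued functions; $F(\theta)=\frac1N\sum_{i=1}^Nf_i(\theta)$. $\bar\rho=\max_{\theta,\theta'\in\mathcal C}\|\theta-\theta'\|_2$. When $F$ is $\mu$-strongly convex with $\mu>0$, $\theta^\star$ is the unique minimizer of $F$ over $\mathcal C$ and $\delta=\min_{s\in\partial\mathcal C}\|s-\theta^\star\|_2$, where $\partial\mathcal C$ is the boundary of $\mathcal C$. A function $f$ is $L$-smooth if $f(\theta)-f(\theta')\le\langle\nabla f(\theta'),\theta-\theta'\rangle+\frac L2\|\theta-\theta'\|_2^2$ for all $\theta,\theta'\in E$, which the paper takes as equivalent to $\|\nabla f(\theta)-\nabla f(\theta')\|_2\le L\|\theta-\theta'\|_2$. It is $\mu$-strongly convex if $f(\theta)-f(\theta')\le\langle\nabla f(\theta),\theta-\theta'\rangle-\frac\mu2\|\theta-\theta'\|_2^2$ for all $\theta,\theta'\in E$, and convex if this holds with $\mu=0$. DeFW iteration. Initial points $\theta_1^i\in\mathcal C$, $i\in[N]$. For $t=1,2,\dots$: (1) with $\bar\theta_t=\frac1N\sum_{i=1}^N\theta_t^i$ the average iterate, each agent $i$ computes, by some network averaging routine applied to $\{\theta_t^j\}_{j=1}^N$, a local approximation $\bar\theta_t^i$ of $\bar\theta_t$;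 (2) with $\overline{\nabla_tF}=\frac1N\sum_{j=1}^N\nabla f_j(\bar\theta_t^j)$ the average gradient, each agent $i$ computes, by some network averaging routine applied to $\{\nabla f_j(\bar\theta_t^j)\}_{j=1}^N$, a local approximation $\overline{\nabla_t^iF}$ of $\overline{\nabla_tF}$; (3) each agent $i$ picks $a_t^i\in\arg\min_{a\in\mathcal C}\langle\overline{\nabla_t^iF},a\rangle$ and sets $\theta_{t+1}^i=(1-\gamma_t)\bar\theta_t^i+\gamma_ta_t^i$.
   Formalization: The first bound is proved for t≥2, since at t=1 it can fail for an arbitrary starting point; and the averaging of the iterates is assumed to preserve their mean, (1/N)∑_i θ̄_t^i = θ̄_t, without which the bounds can fail. *)

theory Defs
  imports "HOL-Analysis.Analysis"
begin

definition grad :: "('a::real_inner \<Rightarrow> real) \<Rightarrow> 'a \<Rightarrow> 'a" where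
  "grad f x = (THE D. GDERIV f x :> D)"

lemma grad_eqI:
  assumes "GDERIV f x :> D"
  shows "grad f x = D"
  unfolding grad_def
proof (rule the_equality)
  fix D' assume "GDERIV f x :> D'"
  with assms have "(\<lambda>h. inner h D') = (\<lambda>h. inner h D)"
    unfolding gderiv_def by (blast intro: has_derivative_unique)
  then have "inner (D' - D) D' = inner (D' - D) D"
    by (rule fun_cong)
  then have "inner (D' - D) (D' - D) = 0"
    by (simp add: inner_diff_right)
  then show "D' = D"
    by simp
qed (fact assms)

lemma grad_GDERIV:
  fixes f :: "'a::euclidean_space \<Rightarrow> real"
  assumes "f differentiable (at x)"
  shows "GDERIV f x :> grad f x"
proof -
  obtain f' where f': "(f has_derivative f') (at x)"
    using assms unfolding differentiable_def by blast
  interpret bounded_linear f'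
    using f' by (rule has_derivative_bounded_linear)
  define D where "D = (\<Sum>b\<in>Basis. f' b *\<^sub>R b)"
  have "f' h = inner h D" for h
  proof -
    have "f' h = f' (\<Sum>b\<in>Basis. inner h b *\<^sub>R b)"
      by (simp add: euclidean_representation)
    then show ?thesis
      by (simp add: D_def sum scaleR inner_sum_right mult.commute)
  qed
  then have "f' = (\<lambda>h. inner h D)"
    by (rule ext)
  with f' have "GDERIV f x :> D"
    unfolding gderiv_def by (rule subst[rotated])
  with grad_eqI[OF this] show ?thesis
    by simp
qed

definition continuously_differentiable :: "('a::real_inner \<Rightarrow> real) \<Rightarrow> bool" where
  "continuously_differentiable f \<longleftrightarrow>
     (\<forall>x. f differentiable (at x)) \<and> continuous_on UNIV (grad f)"

definition smooth :: "real \<Rightarrow> ('a::real_inner \<Rightarrow> real) \<Rightarrow> bool" where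
  "smooth L f \<longleftrightarrow>
     (\<forall>x y. f x - f y \<le> inner (grad f y) (x - y) + L / 2 * (norm (x - y))\<^sup>2)"

text \<open>The case \<open>\<mu> = 0\<close> is first-order convexity of a differentiable function.\<close>

definition strongly_convex :: "real \<Rightarrow> ('a::real_inner \<Rightarrow> real) \<Rightarrow> bool" where
  "strongly_convex \<mu> f \<longleftrightarrow>
     (\<forall>x y. f x - f y \<le> inner (grad f x) (x - y) - \<mu> / 2 * (norm (x - y))\<^sup>2)"

definition average :: "nat \<Rightarrow> (nat \<Rightarrow> 'a::real_vector) \<Rightarrow> 'a" where
  "average N x = (1 / real N) *\<^sub>R (\<Sum>i = 1..N. x i)"

text \<open>
  A run of the decentralized Frank-Wolfe iteration with step sizes \<open>\<gamma>\<close>. Rounds \<open>t\<close> start at 1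
  and agents \<open>i\<close> range over \<open>{1..N}\<close>; values outside these ranges are irrelevant.
  \<open>\<theta> t i\<close> is the iterate of agent \<open>i\<close>, \<open>\<theta>loc t i\<close> its local approximation of the
  average iterate, \<open>gloc t i\<close> its local approximation of the average gradient, and \<open>a t i\<close> an
  arbitrary minimizer returned by its linear oracle. How accurate the local approximations
  are is not part of this predicate. The only requirement on them is that averaging the iterates
  over the network leaves their mean unchanged, as exact and gossip-type (doubly stochastic)
  averaging do; without it the average iterate would drift away from the Frank-Wolfe
  recursion.
\<close>

definition DeFW ::
  "nat \<Rightarrow> 'a::real_inner set \<Rightarrow> (nat \<Rightarrow> real) \<Rightarrow>
   (nat \<Rightarrow> nat \<Rightarrow> 'a) \<Rightarrow> (nat \<Rightarrow> nat \<Rightarrow> 'a) \<Rightarrow> (nat \<Rightarrow> nat \<Rightarrow> 'a) \<Rightarrow> (nat \<Rightarrow> nat \<Rightarrow> 'a) \<Rightarrow> bool" where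
  "DeFW N C \<gamma> \<theta> \<theta>loc gloc a \<longleftrightarrow>
     (\<forall>i\<in>{1..N}. \<theta> 1 i \<in> C) \<and>
     (\<forall>t\<ge>1. average N (\<theta>loc t) = average N (\<theta> t)) \<and>
     (\<forall>t\<ge>1. \<forall>i\<in>{1..N}.
        is_arg_min (\<lambda>x. inner (gloc t i) x) (\<lambda>x. x \<in> C) (a t i) \<and>
        \<theta> (t + 1) i = (1 - \<gamma> t) *\<^sub>R \<theta>loc t i + \<gamma> t *\<^sub>R a t i)"

end

theory Submission
  imports Defs
begin

text \<open>
  The mean iterate performs an inexact Frank-Wolfe step. Convexity and smoothness make the gradients
  \<open>L\<close>-Lipschitz, so \<open>gloc t i\<close> differs from the gradient of \<open>F\<close> at the mean iterate by at most
  \<open>K / t\<close> with \<open>K = Cg + L * Cp\<close>. Comparing the linear minimiser with a point \<open>y\<close> of \<open>C\<close>, the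
  suboptimality \<open>h\<close> decreases by \<open>\<gamma>\<close> times the linear gap at \<open>y\<close>, up to
  \<open>\<gamma> * \<rho> * K / t + \<gamma>\<^sup>2 * L * \<rho>\<^sup>2 / 2\<close>. With \<open>y = \<theta>star\<close> this gives the rate \<open>1 / t\<close>. For an interior
  minimiser take \<open>y = \<theta>star - \<delta> *\<^sub>R sgn (grad F x)\<close>: the gap is then at least
  \<open>h + \<delta> * norm (grad F x)\<close>, and strong convexity gives \<open>norm (grad F x) \<ge> sqrt (2 * \<mu> * h)\<close>. Keeping
  both \<open>h\<close> and \<open>\<delta> * sqrt (2 * \<mu> * h)\<close> closes the induction for the rate \<open>1 / t\<^sup>2\<close>.
\<close>

section \<open>Linearity and monotonicity of averages\<close>

lemma inner_average_left: "inner (average N x) y = average N (\<lambda>i. inner (x i) y)"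
  by (simp add: average_def inner_sum_left)

lemma inner_average_right: "inner y (average N x) = average N (\<lambda>i. inner y (x i))"
  by (simp add: average_def inner_sum_right)

lemma average_const: "N \<ge> 1 \<Longrightarrow> average N (\<lambda>i. c) = c"
  by (simp add: average_def sum_constant_scaleR)

lemma average_add: "average N (\<lambda>i. x i + y i) = average N x + average N y"
  by (simp add: average_def sum.distrib scaleR_right_distrib)

lemma average_diff: "average N (\<lambda>i. x i - y i) = average N x - average N y"
  by (simp add: average_def sum_subtractf scaleR_right_diff_distrib)

lemma average_scaleR: "average N (\<lambda>i. c *\<^sub>R x i) = c *\<^sub>R average N x"
  by (simp add: average_def scaleR_sum_right mult.commute)

lemma average_mono:
  fixes x y :: "nat \<Rightarrow> real"
  assumes "\<And>i. i \<in> {1..N} \<Longrightarrow> x i \<le> y i"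
  shows "average N x \<le> average N y"
  unfolding average_def using assms by (intro scaleR_left_mono sum_mono) auto

lemma average_cong:
  "(\<And>i. i \<in> {1..N} \<Longrightarrow> x i = y i) \<Longrightarrow> average N x = average N y"
  unfolding average_def by (metis (no_types, lifting) sum.cong)

lemma norm_average_le:
  assumes "N \<ge> 1" "\<And>i. i \<in> {1..N} \<Longrightarrow> norm (x i) \<le> B"
  shows "norm (average N x) \<le> B"
proof -
  have "norm (average N x) \<le> average N (\<lambda>i. norm (x i))"
    unfolding average_def using norm_sum[of x "{1..N}"] by (simp add: divide_right_mono)
  also have "\<dots> \<le> average N (\<lambda>i. B)"
    using assms(2) by (rule average_mono)
  finally show ?thesis
    using assms(1) by (simp add: average_const)
qed

lemma average_in_convex:
  assumes "convex C" "N \<ge> 1" "\<And>i. i \<in> {1..N} \<Longrightarrow> x i \<in> C"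
  shows "average N x \<in> C"
  unfolding average_def scaleR_sum_right using assms by (intro convex_sum) auto

section \<open>Calculus, smoothness and convexity of an averaged function\<close>

lemma GDERIV_average:
  fixes f :: "nat \<Rightarrow> 'a::euclidean_space \<Rightarrow> real"
  assumes "\<And>i. i \<in> {1..N} \<Longrightarrow> f i differentiable (at x)"
  shows "GDERIV (\<lambda>x. average N (\<lambda>i. f i x)) x :> average N (\<lambda>i. grad (f i) x)"
proof -
  have "(f i has_derivative (\<lambda>h. inner h (grad (f i) x))) (at x)" if "i \<in> {1..N}" for i
    using grad_GDERIV[OF assms[OF that]] by (simp add: gderiv_def)
  then have "((\<lambda>x. average N (\<lambda>i. f i x)) has_derivative
      (\<lambda>h. average N (\<lambda>i. inner h (grad (f i) x)))) (at x)"
    unfolding average_def by (intro has_derivative_scaleR_right has_derivative_sum)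
  then show ?thesis
    by (simp add: gderiv_def inner_average_right)
qed

lemma smooth_average:
  fixes f :: "nat \<Rightarrow> 'a::euclidean_space \<Rightarrow> real"
  assumes "N \<ge> 1" "\<And>i x. i \<in> {1..N} \<Longrightarrow> f i differentiable (at x)"
    and "\<And>i. i \<in> {1..N} \<Longrightarrow> smooth L (f i)"
  shows "smooth L (\<lambda>x. average N (\<lambda>i. f i x))"
  unfolding smooth_def
proof (intro allI)
  fix x y
  have "average N (\<lambda>i. f i x - f i y)
      \<le> average N (\<lambda>i. inner (grad (f i) y) (x - y) + L / 2 * (norm (x - y))\<^sup>2)"
    using assms(3) unfolding smooth_def by (intro average_mono) blast
  then show "average N (\<lambda>i. f i x) - average N (\<lambda>i. f i y)
      \<le> inner (grad (\<lambda>x. average N (\<lambda>i. f i x)) y) (x - y) + L / 2 * (norm (x - y))\<^sup>2"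
    using grad_eqI[OF GDERIV_average[of N f y]] assms(1,2)
    by (simp add: average_diff average_add average_const inner_average_left)
qed

lemma strongly_convex_average:
  fixes f :: "nat \<Rightarrow> 'a::euclidean_space \<Rightarrow> real"
  assumes "N \<ge> 1" "\<And>i x. i \<in> {1..N} \<Longrightarrow> f i differentiable (at x)"
    and "\<And>i. i \<in> {1..N} \<Longrightarrow> strongly_convex \<mu> (f i)"
  shows "strongly_convex \<mu> (\<lambda>x. average N (\<lambda>i. f i x))"
  unfolding strongly_convex_def
proof (intro allI)
  fix x y
  have "average N (\<lambda>i. f i x - f i y)
      \<le> average N (\<lambda>i. inner (grad (f i) x) (x - y) - \<mu> / 2 * (norm (x - y))\<^sup>2)"
    using assms(3) unfolding strongly_convex_def by (intro average_mono) blast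
  then show "average N (\<lambda>i. f i x) - average N (\<lambda>i. f i y)
      \<le> inner (grad (\<lambda>x. average N (\<lambda>i. f i x)) x) (x - y) - \<mu> / 2 * (norm (x - y))\<^sup>2"
    using grad_eqI[OF GDERIV_average[of N f x]] assms(1,2)
    by (simp add: average_diff average_const inner_average_left)
qed

section \<open>Inequalities for smooth and strongly convex functions\<close>

lemma strong_convexity_le_smoothness:
  fixes f :: "'a::euclidean_space \<Rightarrow> real"
  assumes "strongly_convex \<mu> f" "smooth L f"
  shows "\<mu> \<le> L"
proof -
  obtain b :: 'a where "b \<in> Basis"
    using nonempty_Basis by blast
  then have b: "norm b = 1"
    by simp
  \<comment> \<open>Both inequalities use the gradient at 0, so their first-order terms cancel in
    the sum and \<open>0 \<le> (L - \<mu>) / 2\<close> remains. The case \<open>\<mu> = 0\<close>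
    supplies the sign of \<open>L\<close>, which \<open>smooth\<close> leaves open.\<close>
  have "f 0 - f b \<le> inner (grad f 0) (0 - b) - \<mu> / 2 * (norm (0 - b))\<^sup>2"
    using assms(1) unfolding strongly_convex_def by blast
  moreover have "f b - f 0 \<le> inner (grad f 0) (b - 0) + L / 2 * (norm (b - 0))\<^sup>2"
    using assms(2) unfolding smooth_def by blast
  ultimately show ?thesis
    using b by simp
qed

text \<open>Compare the tangent at \<open>x\<close> with \<open>f\<close> at the point reached from \<open>y\<close> by a gradient step of length
  \<open>s\<close> for the function \<open>\<lambda>z. f z - inner (grad f x) z\<close>, which \<open>x\<close> minimises.\<close>

lemma smooth_convex_gradient_gap:
  assumes cvx: "strongly_convex 0 f" and smooth: "smooth L f"
  shows "f x - f y \<le> inner (grad f x) (x - y)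
           - (s - L / 2 * s\<^sup>2) * (norm (grad f y - grad f x))\<^sup>2"
proof -
  define g where "g = grad f y - grad f x"
  define z where "z = y - s *\<^sub>R g"
  have "f x - f z \<le> inner (grad f x) (x - z)"
    using cvx unfolding strongly_convex_def by (metis diff_zero div_0 mult_zero_left)
  moreover have "f z - f y \<le> inner (grad f y) (z - y) + L / 2 * (norm (z - y))\<^sup>2"
    using smooth unfolding smooth_def by blast
  moreover have "inner (grad f x) (x - z) + inner (grad f y) (z - y)
      = inner (grad f x) (x - y) - s * (norm g)\<^sup>2"
    unfolding z_def g_def power2_norm_eq_inner
    by (simp add: inner_diff_left inner_diff_right inner_commute algebra_simps)
  moreover have "(norm (z - y))\<^sup>2 = s\<^sup>2 * (norm g)\<^sup>2"
    by (simp add: z_def power_mult_distrib)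
  ultimately show ?thesis
    unfolding g_def[symmetric] by (simp add: algebra_simps)
qed

text \<open>Adding the gap inequality to its copy with \<open>x\<close> and \<open>y\<close>
  exchanged removes the function values and leaves a co-coercivity bound with a free step length
  \<open>s\<close>.\<close>

lemma smooth_convex_gradient_Lipschitz:
  assumes "strongly_convex 0 f" "smooth L f" "L \<ge> 0"
  shows "norm (grad f x - grad f y) \<le> L * norm (x - y)"
proof -
  define g where "g = norm (grad f x - grad f y)"
  have gap: "(2 * s - L * s\<^sup>2) * g\<^sup>2 \<le> g * norm (x - y)" for s
  proof -
    have "2 * (s - L / 2 * s\<^sup>2) * g\<^sup>2 \<le> inner (grad f x - grad f y) (x - y)"
      using smooth_convex_gradient_gap[OF assms(1,2), of x y s]
        smooth_convex_gradient_gap[OF assms(1,2), of y x s]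
      unfolding g_def norm_minus_commute[of "grad f y" "grad f x"]
      by (simp add: inner_diff_left inner_diff_right algebra_simps)
    also have "\<dots> \<le> g * norm (x - y)"
      unfolding g_def by (rule norm_cauchy_schwarz)
    finally show ?thesis
      by (simp add: algebra_simps)
  qed
  show ?thesis
  proof (cases "g = 0")
    case False
    then have "g > 0"
      by (simp add: g_def)
    have *: "(2 * s - L * s\<^sup>2) * g \<le> norm (x - y)" for s
      using gap[of s] \<open>g > 0\<close> by (simp add: power2_eq_square mult.left_commute)
    show ?thesis
    \<comment> \<open>For \<open>L > 0\<close> the choice \<open>s = 1 / L\<close> maximises
      \<open>2 * s - L * s\<^sup>2\<close>. For \<open>L = 0\<close> there is no maximiser and a
      nonzero gradient difference is contradictory: one value of \<open>s\<close> forces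
      \<open>norm (x - y)\<close> to be 0, the other forces it to be at least 2.\<close>
    proof (cases "L = 0")
      case True
      have "2 * (norm (x - y) / g) * g \<le> norm (x - y)" "2 * (1 / g) * g \<le> norm (x - y)"
        using *[of "norm (x - y) / g"] *[of "1 / g"] True by simp_all
      then show ?thesis
        using \<open>g > 0\<close> by simp
    next
      case False
      then have "L > 0"
        using assms(3) by simp
      have "(1 / L) * g \<le> norm (x - y)"
        using *[of "1 / L"] \<open>L > 0\<close> by (simp add: power2_eq_square)
      then show ?thesis
        using \<open>L > 0\<close> by (simp add: g_def field_simps)
    qed
  qed (use assms(3) in \<open>simp add: g_def\<close>)
qed

text \<open>Polyak-Lojasiewicz inequality. After Cauchy-Schwarz the bound is a concave quadratic in
  the distance \<open>d\<close>; completing the square gives its maximum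
  \<open>g\<^sup>2 / (2 * \<mu>)\<close>.\<close>

lemma strongly_convex_gradient_dominates:
  assumes "strongly_convex \<mu> f" "\<mu> > 0"
  shows "2 * \<mu> * (f x - f y) \<le> (norm (grad f x))\<^sup>2"
proof -
  define d where "d = norm (x - y)"
  define g where "g = norm (grad f x)"
  have "f x - f y \<le> inner (grad f x) (x - y) - \<mu> / 2 * d\<^sup>2"
    using assms(1) unfolding strongly_convex_def d_def by blast
  also have "\<dots> \<le> g * d - \<mu> / 2 * d\<^sup>2"
    using norm_cauchy_schwarz unfolding g_def d_def by simp
  finally have "2 * \<mu> * (f x - f y) \<le> 2 * \<mu> * (g * d - \<mu> / 2 * d\<^sup>2)"
    using assms(2) by (intro mult_left_mono) auto
  also have "\<dots> = g\<^sup>2 - (g - \<mu> * d)\<^sup>2"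
    by (simp add: power2_eq_square algebra_simps)
  finally show ?thesis
    unfolding g_def by (smt (verit) zero_le_power2)
qed

section \<open>Geometry at an interior minimiser\<close>

lemma grad_eq_0_at_interior_min:
  fixes f :: "'a::euclidean_space \<Rightarrow> real"
  assumes "f differentiable (at x)" "is_arg_min f (\<lambda>x. x \<in> C) x" "x \<in> interior C"
  shows "grad f x = 0"
proof -
  have "(f has_derivative (\<lambda>h. inner h (grad f x))) (at x)"
    using grad_GDERIV[OF assms(1)] by (simp add: gderiv_def)
  moreover have "\<forall>y\<in>interior C. f x \<le> f y"
    using assms(2) interior_subset[of C] by (auto simp: is_arg_min_linorder)
  ultimately have "(\<lambda>h. inner h (grad f x)) = (\<lambda>v. 0)"
    using assms(3) by (intro differential_zero_maxmin[of x "interior C" f]) auto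
  then show ?thesis
    by (metis inner_eq_zero_iff)
qed

lemma cball_infdist_frontier_subset:
  fixes C :: "'a::euclidean_space set"
  assumes "closed C" "bounded C" "x \<in> interior C"
  defines "\<delta> \<equiv> infdist x (frontier C)"
  shows "0 < \<delta>" "\<delta> \<le> diameter C" "cball x \<delta> \<subseteq> C"
proof -
  have "x \<in> C"
    using assms(3) interior_subset by blast
  \<comment> \<open>The frontier must be nonempty: \<open>infdist\<close> to the empty set is 0 by
    convention, which would break positivity.\<close>
  have "C \<noteq> UNIV"
    using assms(2) not_bounded_UNIV by blast
  with \<open>x \<in> C\<close> have ne: "frontier C \<noteq> {}"
    by (metis empty_iff frontier_eq_empty)
  have "x \<notin> frontier C"
    using assms(3) by (simp add: frontier_def)
  then show pos: "0 < \<delta>"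
    unfolding \<delta>_def using infdist_pos_not_in_closed[OF frontier_closed ne] by blast
  obtain y where y: "y \<in> frontier C"
    using ne by blast
  then have "y \<in> C"
    using frontier_subset_closed[OF assms(1)] by blast
  have "\<delta> \<le> dist x y"
    unfolding \<delta>_def by (rule infdist_le[OF y])
  also have "\<dots> \<le> diameter C"
    using assms(2) \<open>x \<in> C\<close> \<open>y \<in> C\<close> by (rule diameter_bounded_bound)
  finally show "\<delta> \<le> diameter C" .
  \<comment> \<open>A connected set that meets \<open>C\<close> but not its frontier cannot leave
    \<open>C\<close>; closedness then admits the bounding sphere.\<close>
  have "ball x \<delta> \<inter> frontier C = {}"
    unfolding \<delta>_def using infdist_le[of _ "frontier C" x] by force
  moreover have "ball x \<delta> \<inter> C \<noteq> {}"
    using pos \<open>x \<in> C\<close> by force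
  ultimately have "ball x \<delta> \<subseteq> C"
    using connected_Int_frontier[OF connected_ball, of x \<delta> C] by blast
  then have "closure (ball x \<delta>) \<subseteq> C"
    using assms(1) by (rule closure_minimal)
  then show "cball x \<delta> \<subseteq> C"
    using pos by simp
qed

section \<open>One inexact Frank-Wolfe step and the scalar recursions\<close>

lemma frank_wolfe_step:
  assumes "smooth L F" "L \<ge> 0" "bounded C" "x \<in> C" "v \<in> C" "0 \<le> \<gamma>"
    and lmo: "inner (grad F x) (v - y) \<le> \<epsilon>"
  shows "F ((1 - \<gamma>) *\<^sub>R x + \<gamma> *\<^sub>R v)
    \<le> F x + \<gamma> * (inner (grad F x) (y - x) + \<epsilon>) + \<gamma>\<^sup>2 * (L * (diameter C)\<^sup>2) / 2"
proof -
  define z where "z = (1 - \<gamma>) *\<^sub>R x + \<gamma> *\<^sub>R v"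
  have z: "z - x = \<gamma> *\<^sub>R (v - x)"
    by (simp add: z_def algebra_simps)
  have "F z - F x \<le> inner (grad F x) (z - x) + L / 2 * (norm (z - x))\<^sup>2"
    using assms(1) unfolding smooth_def by blast
  \<comment> \<open>Split \<open>v - x\<close> as \<open>(v - y) + (y - x)\<close>; the first part
    is the oracle error. Leaving \<open>y\<close> free permits comparison points other than the
    minimiser.\<close>
  moreover have "inner (grad F x) (z - x) \<le> \<gamma> * (inner (grad F x) (y - x) + \<epsilon>)"
    unfolding z using lmo assms(6) by (simp add: inner_diff_right mult_left_mono)
  moreover have "(norm (v - x))\<^sup>2 \<le> (diameter C)\<^sup>2"
    using diameter_bounded_bound[OF assms(3,5,4)] by (simp add: dist_norm power_mono)
  then have "\<gamma>\<^sup>2 * (L / 2) * (norm (v - x))\<^sup>2 \<le> \<gamma>\<^sup>2 * (L / 2) * (diameter C)\<^sup>2"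
    using assms(2) by (intro mult_left_mono) auto
  then have "L / 2 * (norm (z - x))\<^sup>2 \<le> \<gamma>\<^sup>2 * (L * (diameter C)\<^sup>2) / 2"
    unfolding z by (simp add: power_mult_distrib mult_ac)
  ultimately show ?thesis
    unfolding z_def by linarith
qed

text \<open>Since \<open>1 / t \<le> 2 / (t + 1)\<close>, the network error has the same order as
  the curvature term, at the cost of a factor 2 on \<open>A\<close>.\<close>

lemma perturbation_bound:
  fixes t A B :: real
  assumes "t \<ge> 1" "A \<ge> 0"
  shows "2 / (t + 1) * (A / t) + (2 / (t + 1))\<^sup>2 * B / 2 \<le> (4 * A + 2 * B) / (t + 1)\<^sup>2"
proof -
  have "1 / t \<le> 2 / (t + 1)"
    using assms(1) by (simp add: field_simps)
  then have "(2 * A / (t + 1)) * (1 / t) \<le> (2 * A / (t + 1)) * (2 / (t + 1))"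
    using assms by (intro mult_left_mono) auto
  then show ?thesis
    using assms(1) by (simp add: power2_eq_square add_divide_distrib power_divide)
qed

text \<open>The induction starts at 2 because the step size at time 1 equals 1: it erases
  \<open>h 1\<close>, on which there is no bound, and leaves
  \<open>h 2 \<le> A + B / 2\<close>.\<close>

lemma sublinear_recursion:
  fixes h :: "nat \<Rightarrow> real"
  assumes "A \<ge> 0" "B \<ge> 0"
    and step: "\<And>t. t \<ge> 1 \<Longrightarrow> h (t + 1) \<le> (1 - 2 / (real t + 1)) * h t
        + (2 / (real t + 1) * (A / real t) + (2 / (real t + 1))\<^sup>2 * B / 2)"
    and "t \<ge> 2"
  shows "h t \<le> (8 * A + 2 * B) / (real t + 1)"
  using \<open>t \<ge> 2\<close>
proof (induction t rule: dec_induct)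
  case base
  show ?case
    using step[of 1] assms(1,2) by (simp add: numeral_2_eq_2)
next
  case (step t)
  define n where "n = real t + 1"
  define D where "D = 8 * A + 2 * B"
  have n: "n \<ge> 3" and D: "D \<ge> 0"
    using step.hyps assms(1,2) by (auto simp: n_def D_def)
  have "h (t + 1) \<le> (1 - 2 / n) * h t + (4 * A + 2 * B) / n\<^sup>2"
    using assms(3)[of t] perturbation_bound[of "real t" A B] step.hyps assms(1)
    unfolding n_def by fastforce
  also have "\<dots> \<le> (1 - 2 / n) * (D / n) + D / n\<^sup>2"
    using step.IH n assms(1) unfolding n_def[symmetric] D_def[symmetric]
    by (intro add_mono mult_left_mono divide_right_mono) (auto simp: D_def)
  also have "\<dots> = D * ((n - 1) / n\<^sup>2)"
    using n by (simp add: power2_eq_square field_simps)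
  \<comment> \<open>This is \<open>(n - 1) * (n + 1) \<le> n\<^sup>2\<close>.\<close>
  also have "\<dots> \<le> D * (1 / (n + 1))"
    using n D by (intro mult_left_mono) (auto simp: divide_simps power2_eq_square algebra_simps)
  finally show ?case
    by (simp add: n_def D_def add_ac)
qed

text \<open>At \<open>sqrt (h t) = S n\<close> the extra decrease is
  \<open>2 / n * q * S n = 6 * D / n\<^sup>2\<close>, which outweighs the noise of at most
  \<open>2 * D / n\<^sup>2\<close>; this fits the factor 3 in \<open>S\<close>. The contraction
  \<open>1 - 2 / n\<close> alone then carries the rate.\<close>

lemma quadratic_recursion:
  fixes h :: "nat \<Rightarrow> real"
  assumes "A \<ge> 0" "B \<ge> 0" "q > 0" "q\<^sup>2 \<le> 2 * B" and h0: "\<And>t. t \<ge> 1 \<Longrightarrow> h t \<ge> 0" and "h 1 \<le> B / 2"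
    and step: "\<And>t. t \<ge> 1 \<Longrightarrow> h (t + 1) \<le> (1 - 2 / (real t + 1)) * h t
        - 2 / (real t + 1) * (q * sqrt (h t))
        + (2 / (real t + 1) * (A / real t) + (2 / (real t + 1))\<^sup>2 * B / 2)"
    and "t \<ge> 1"
  shows "h t \<le> (4 * A + B)\<^sup>2 / q\<^sup>2 * (9 / (real t + 1)\<^sup>2)"
proof -
  define D where "D = 4 * A + B"
  have "B > 0"
    using assms(3,4) zero_less_power2[of q] by linarith
  then have D: "D > 0" "B \<le> D"
    using assms(1) by (auto simp: D_def)
  define S where "S n = 3 * D / (q * n)" for n
  have S2: "(S n)\<^sup>2 = D\<^sup>2 / q\<^sup>2 * (9 / n\<^sup>2)" for n
    by (simp add: S_def power_divide power_mult_distrib)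
  have "q\<^sup>2 \<le> 2 * D"
    using assms(4) D by linarith
  then have qD: "D / q\<^sup>2 \<ge> 1 / 2"
    using assms(3) by (simp add: field_simps)
  \<comment> \<open>Makes the target at least \<open>D / 2 * (9 / n\<^sup>2)\<close>, which covers
    both the start and the steps where only noise is left.\<close>
  then have DDq: "D\<^sup>2 / q\<^sup>2 \<ge> D / 2"
    using mult_left_mono[OF qD, of D] D by (simp add: power2_eq_square)
  have "h t \<le> (S (real t + 1))\<^sup>2"
    using \<open>t \<ge> 1\<close>
  proof (induction t rule: dec_induct)
    case base
    show ?case
      using assms(6) D DDq unfolding S2 by simp
  next
    case (step t)
    define n where "n = real t + 1"
    define s where "s = sqrt (h t)"
    have n: "n \<ge> 2"
      using step.hyps by (simp add: n_def)
    have ht: "h t = s\<^sup>2" and s: "s \<ge> 0"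
      using h0[of t] step.hyps by (auto simp: s_def)
    have Sn: "S n \<ge> 0"
      using n D assms(3) by (simp add: S_def)
    have "s \<le> S n"
      using step.IH Sn unfolding n_def[symmetric] ht by (rule power2_le_imp_le)
    have "h (t + 1) \<le> (1 - 2 / n) * h t - 2 / n * (q * s) + (4 * A + 2 * B) / n\<^sup>2"
      using assms(7)[of t] perturbation_bound[of "real t" A B] step.hyps assms(1)
      unfolding n_def s_def by fastforce
    then have "h (t + 1) \<le> (1 - 2 / n) * s\<^sup>2 - 2 / n * (q * s) + (4 * A + 2 * B) / n\<^sup>2"
      unfolding ht .
    also have "\<dots> \<le> ((1 - 2 / n) * s - 2 * q / n) * s + 2 * D / n\<^sup>2"
      using assms(1,2) n by (simp add: algebra_simps power2_eq_square D_def divide_right_mono)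
    also have "\<dots> \<le> (S (n + 1))\<^sup>2"
    \<comment> \<open>The quadratic in \<open>s\<close> is not monotone near 0, so
      \<open>s \<le> S n\<close> cannot be inserted at once. If the first factor is nonpositive,
      only the noise remains, and \<open>2 * (n + 1) \<le> 3 * n\<close> suffices. Otherwise both
      factors are nonnegative and increase with \<open>s\<close>.\<close>
    proof (cases "(1 - 2 / n) * s - 2 * q / n \<le> 0")
      case True
      then have "((1 - 2 / n) * s - 2 * q / n) * s + 2 * D / n\<^sup>2 \<le> 2 * D / n\<^sup>2"
        using s by (simp add: mult_nonpos_nonneg)
      also have "\<dots> \<le> D / 2 * (9 / (n + 1)\<^sup>2)"
      proof -
        have "(2 * (n + 1))\<^sup>2 \<le> (3 * n)\<^sup>2"
          using n by (intro power_mono) auto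
        then have "4 * (n + 1)\<^sup>2 \<le> 9 * n\<^sup>2"
          by (simp only: power_mult_distrib) simp
        then have "D * (4 * (n + 1)\<^sup>2) \<le> D * (9 * n\<^sup>2)"
          using D by (intro mult_left_mono) auto
        then show ?thesis
          using n by (simp add: field_simps)
      qed
      also have "\<dots> \<le> (S (n + 1))\<^sup>2"
        unfolding S2 using DDq by (intro mult_right_mono) auto
      finally show ?thesis .
    next
      case False
      have "((1 - 2 / n) * s - 2 * q / n) * s \<le> ((1 - 2 / n) * S n - 2 * q / n) * S n"
      proof (rule mult_mono')
        show "(1 - 2 / n) * s - 2 * q / n \<le> (1 - 2 / n) * S n - 2 * q / n"
          using \<open>s \<le> S n\<close> n by (intro diff_right_mono mult_left_mono) auto
      qed (use False s \<open>s \<le> S n\<close> in auto)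
      also have "\<dots> = (1 - 2 / n) * (S n)\<^sup>2 - 6 * D / n\<^sup>2"
        using assms(3) n by (simp add: left_diff_distrib power2_eq_square S_def field_simps)
      also have "\<dots> + 2 * D / n\<^sup>2 \<le> (1 - 2 / n) * (S n)\<^sup>2"
        using D n by (simp add: divide_right_mono)
      also have "\<dots> = 9 * D\<^sup>2 / q\<^sup>2 * ((1 - 2 / n) / n\<^sup>2)"
        unfolding S2 by simp
      also have "\<dots> \<le> 9 * D\<^sup>2 / q\<^sup>2 * (1 / (n + 1)\<^sup>2)"
      proof (rule mult_left_mono)
        \<comment> \<open>The left side expands to n^3 - 3n - 2.\<close>
        have "(n - 2) * (n + 1)\<^sup>2 \<le> n * n\<^sup>2"
          using n by (simp add: power2_eq_square algebra_simps)
        then have "(n - 2) / (n * n\<^sup>2) \<le> 1 / (n + 1)\<^sup>2"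
          using n by (simp add: divide_simps)
        then show "(1 - 2 / n) / n\<^sup>2 \<le> 1 / (n + 1)\<^sup>2"
          using n by (simp add: diff_divide_distrib)
      qed simp
      also have "\<dots> = (S (n + 1))\<^sup>2"
        unfolding S2 by simp
      finally show ?thesis
        by simp
    qed
    finally show ?case
      by (simp add: n_def add_ac)
  qed
  then show ?thesis
    unfolding S2 D_def .
qed

section \<open>The mean iterate of a DeFW run\<close>

lemma DeFW_average_step:
  assumes "DeFW N C \<gamma> \<theta> \<theta>loc gloc a" "t \<ge> 1"
  shows "average N (\<theta> (t + 1)) = (1 - \<gamma> t) *\<^sub>R average N (\<theta> t) + \<gamma> t *\<^sub>R average N (a t)"
proof -
  have "average N (\<theta> (t + 1)) = average N (\<lambda>i. (1 - \<gamma> t) *\<^sub>R \<theta>loc t i + \<gamma> t *\<^sub>R a t i)"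
    using assms unfolding DeFW_def by (intro average_cong) blast
  \<comment> \<open>Averaging over the network preserves the mean, so the mean iterate takes a
    Frank-Wolfe step without drift; inexactness enters only through the oracle points.\<close>
  then show ?thesis
    using assms unfolding DeFW_def by (simp add: average_add average_scaleR)
qed

text \<open>Individual values \<open>\<theta>loc t i\<close> may lie outside \<open>C\<close>, so
  the induction runs on the mean, a convex combination of the previous mean and averaged oracle
  points.\<close>

lemma DeFW_average_in_domain:
  assumes run: "DeFW N C \<gamma> \<theta> \<theta>loc gloc a" and "N \<ge> 1" "convex C"
    and \<gamma>: "\<And>t. t \<ge> 1 \<Longrightarrow> 0 \<le> \<gamma> t \<and> \<gamma> t \<le> 1" and "t \<ge> 1"
  shows "average N (\<theta> t) \<in> C"
  using \<open>t \<ge> 1\<close>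
proof (induction t rule: dec_induct)
  case base
  show ?case
    using run assms(2,3) unfolding DeFW_def by (intro average_in_convex) blast+
next
  case (step t)
  have "average N (a t) \<in> C"
    using run step.hyps assms(2,3) unfolding DeFW_def is_arg_min_linorder
    by (intro average_in_convex) blast+
  then show ?case
    using DeFW_average_step[OF run step.hyps(1)] step.IH \<gamma>[OF step.hyps(1)] assms(3)
    by (auto intro: convexD)
qed

text \<open>Exact linear minimisation for \<open>gloc t i\<close> is inexact linear minimisation for the true gradient \<open>G\<close>.\<close>

lemma DeFW_oracle_error:
  assumes run: "DeFW N C \<gamma> \<theta> \<theta>loc gloc a" and "N \<ge> 1" "bounded C" "t \<ge> 1" "y \<in> C"
    and err: "\<And>i. i \<in> {1..N} \<Longrightarrow> norm (G - gloc t i) \<le> \<epsilon>"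
  shows "inner G (average N (a t) - y) \<le> diameter C * \<epsilon>"
proof -
  have "inner G (a t i - y) \<le> diameter C * \<epsilon>" if i: "i \<in> {1..N}" for i
  proof -
    have min: "is_arg_min (\<lambda>x. inner (gloc t i) x) (\<lambda>x. x \<in> C) (a t i)"
      using run i assms(4) unfolding DeFW_def by blast
    then have "a t i \<in> C" and "inner (gloc t i) (a t i - y) \<le> 0"
      using assms(5) by (auto simp: is_arg_min_linorder inner_diff_right)
    then have "inner G (a t i - y) \<le> inner (G - gloc t i) (a t i - y)"
      by (simp add: inner_diff_left)
    also have "\<dots> \<le> norm (a t i - y) * norm (G - gloc t i)"
      using norm_cauchy_schwarz by (metis mult.commute)
    also have "\<dots> \<le> diameter C * \<epsilon>"
      using diameter_bounded_bound[OF assms(3) \<open>a t i \<in> C\<close> assms(5)] err[OF i] assms(3)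
      by (intro mult_mono) (auto simp: dist_norm diameter_ge_0)
    finally show ?thesis .
  qed
  then have "average N (\<lambda>i. inner G (a t i - y)) \<le> average N (\<lambda>i. diameter C * \<epsilon>)"
    by (rule average_mono)
  then show ?thesis
    using assms(2) by (simp add: inner_average_right inner_diff_right average_diff average_const)
qed

section \<open>Convergence rates of the mean iterate\<close>

theorem theorem1:
  fixes N :: nat
    and C :: "'a::euclidean_space set"
    and f :: "nat \<Rightarrow> 'a \<Rightarrow> real"
    and F :: "'a \<Rightarrow> real"
    and \<theta> \<theta>loc gloc a :: "nat \<Rightarrow> nat \<Rightarrow> 'a"
    and \<theta>star :: 'a
    and L Cp Cg \<rho> \<delta> :: real
  defines "F \<equiv> (\<lambda>x. average N (\<lambda>i. f i x))"
    and "\<rho> \<equiv> diameter C"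
    and "\<delta> \<equiv> infdist \<theta>star (frontier C)"
  assumes "N \<ge> 1"
    and "closed C" and "bounded C" and "convex C"
    and "\<forall>i\<in>{1..N}. continuously_differentiable (f i)"
    and "\<forall>i\<in>{1..N}. strongly_convex 0 (f i)"
    and "\<forall>i\<in>{1..N}. smooth L (f i)"
    and "DeFW N C (\<lambda>t. 2 / (real t + 1)) \<theta> \<theta>loc gloc a"
    and "Cp > 0" and "Cg > 0"
    and "\<forall>t\<ge>1. (MAX i\<in>{1..N}. norm (\<theta>loc t i - average N (\<theta> t))) \<le> Cp / real t"
    and "\<forall>t\<ge>1. (MAX i\<in>{1..N}.
           norm (gloc t i - average N (\<lambda>j. grad (f j) (\<theta>loc t j)))) \<le> Cg / real t"
    and "is_arg_min F (\<lambda>x. x \<in> C) \<theta>star"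
  shows "(\<forall>t\<ge>2. F (average N (\<theta> t)) - F \<theta>star
            \<le> (8 * \<rho> * (Cg + L * Cp) + 2 * L * \<rho>\<^sup>2) / (real t + 1)) \<and>
         (\<forall>\<mu>>0. strongly_convex \<mu> F \<and> \<theta>star \<in> interior C \<longrightarrow>
            (\<forall>t\<ge>1. F (average N (\<theta> t)) - F \<theta>star
              \<le> (4 * \<rho> * (Cg + L * Cp) + L * \<rho>\<^sup>2)\<^sup>2 / (2 * \<delta>\<^sup>2 * \<mu>) * (9 / (real t + 1)\<^sup>2)))"
proof -
  note F_def = assms(1) and \<rho>_def = assms(2) and \<delta>_def = assms(3)
  note N = assms(4) and bdd = assms(6) and run = assms(11)
  define x where "x t = average N (\<theta> t)" for t
  define h where "h t = F (x t) - F \<theta>star" for t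
  define K where "K = Cg + L * Cp"
  have diff: "f i differentiable (at y)" if "i \<in> {1..N}" for i y
    using assms(8) that unfolding continuously_differentiable_def by blast
  have gradF: "grad F y = average N (\<lambda>i. grad (f i) y)" for y
    unfolding F_def using diff by (intro grad_eqI GDERIV_average)
  have smoothF: "smooth L F"
    unfolding F_def using N diff assms(10) by (intro smooth_average) auto
  have convexF: "strongly_convex 0 F"
    unfolding F_def using N diff assms(9) by (intro strongly_convex_average) auto
  have L: "L \<ge> 0"
    using strong_convexity_le_smoothness[OF convexF smoothF] .
  have \<rho>: "\<rho> \<ge> 0"
    unfolding \<rho>_def using bdd by (rule diameter_ge_0)
  have K: "K \<ge> 0"
    using L assms(12,13) by (simp add: K_def)
  have star: "\<theta>star \<in> C" "\<And>y. y \<in> C \<Longrightarrow> F \<theta>star \<le> F y"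
    using assms(16) by (auto simp: is_arg_min_linorder)
  have xC: "x t \<in> C" if "t \<ge> 1" for t
    unfolding x_def using that by (intro DeFW_average_in_domain[OF run N assms(7)]) auto
  have h0: "h t \<ge> 0" if "t \<ge> 1" for t
    using star(2)[OF xC[OF that]] by (simp add: h_def)
  \<comment> \<open>Two error sources meet at the average of the local gradients: gradient averaging
    contributes \<open>Cg / t\<close>, and evaluating each \<open>f j\<close> at
    \<open>\<theta>loc t j\<close> instead of the mean contributes \<open>L * Cp / t\<close> by the
    Lipschitz bound.\<close>
  have err: "norm (grad F (x t) - gloc t i) \<le> K / real t" if t: "t \<ge> 1" and i: "i \<in> {1..N}" for t i
  proof -
    let ?G = "average N (\<lambda>j. grad (f j) (\<theta>loc t j))"
    have "norm (gloc t i - ?G) \<le> (MAX i\<in>{1..N}. norm (gloc t i - ?G))"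
      using i by (intro Max_ge) auto
    also have "\<dots> \<le> Cg / real t"
      using assms(15) t by blast
    finally have g: "norm (?G - gloc t i) \<le> Cg / real t"
      by (simp only: norm_minus_commute)
    have "norm (grad (f j) (x t) - grad (f j) (\<theta>loc t j)) \<le> L * (Cp / real t)"
      if j: "j \<in> {1..N}" for j
    proof -
      have "norm (grad (f j) (x t) - grad (f j) (\<theta>loc t j)) \<le> L * norm (x t - \<theta>loc t j)"
        using assms(9,10) j L by (intro smooth_convex_gradient_Lipschitz) auto
      also have "norm (x t - \<theta>loc t j) = norm (\<theta>loc t j - x t)"
        by (rule norm_minus_commute)
      also have "\<dots> \<le> (MAX i\<in>{1..N}. norm (\<theta>loc t i - x t))"
        using j by (intro Max_ge) auto
      also have "\<dots> \<le> Cp / real t"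
        using assms(14) t unfolding x_def by blast
      finally show ?thesis
        using L by (simp add: mult_left_mono)
    qed
    then have "norm (grad F (x t) - ?G) \<le> L * (Cp / real t)"
      unfolding gradF average_diff[symmetric] by (rule norm_average_le[OF N])
    with g have "norm ((grad F (x t) - ?G) + (?G - gloc t i)) \<le> L * (Cp / real t) + Cg / real t"
      by (rule norm_triangle_mono[rotated])
    then show ?thesis
      by (simp add: K_def add_divide_distrib)
  qed
  have descent: "F (x (t + 1)) \<le> F (x t) + 2 / (real t + 1) * (inner (grad F (x t)) (y - x t) + \<rho> * K / real t)
      + (2 / (real t + 1))\<^sup>2 * (L * \<rho>\<^sup>2) / 2" if t: "t \<ge> 1" and y: "y \<in> C" for t y
  proof -
    have aC: "average N (a t) \<in> C"
      using run t N assms(7) unfolding DeFW_def is_arg_min_linorder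
      by (intro average_in_convex) blast+
    have "inner (grad F (x t)) (average N (a t) - y) \<le> \<rho> * (K / real t)"
      unfolding \<rho>_def by (intro DeFW_oracle_error[OF run N bdd t y] err[OF t])
    from frank_wolfe_step[OF smoothF L bdd xC[OF t] aC _ this, of "2 / (real t + 1)"]
    show ?thesis
      using DeFW_average_step[OF run t] by (simp add: x_def \<rho>_def)
  qed
  have gap: "h t \<le> inner (grad F (x t)) (x t - \<theta>star)" for t
    using convexF unfolding strongly_convex_def h_def by (metis diff_zero div_0 mult_zero_left)
  \<comment> \<open>Here \<open>r\<close> is the extra linear decrease of \<open>y\<close> over
    \<open>\<theta>star\<close>: 0 for the first rate, \<open>q * sqrt (h t)\<close> for the
    second.\<close>
  have progress: "h (t + 1) \<le> (1 - 2 / (real t + 1)) * h t - 2 / (real t + 1) * r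
      + (2 / (real t + 1) * (\<rho> * K / real t) + (2 / (real t + 1))\<^sup>2 * (L * \<rho>\<^sup>2) / 2)"
    if t: "t \<ge> 1" and y: "y \<in> C" and r: "inner (grad F (x t)) (y - \<theta>star) \<le> - r" for t y r
  proof -
    have "inner (grad F (x t)) (y - x t) \<le> - h t - r"
      using gap[of t] r by (simp add: inner_diff_right)
    then have "2 / (real t + 1) * (inner (grad F (x t)) (y - x t) + \<rho> * K / real t)
        \<le> 2 / (real t + 1) * ((- h t - r) + \<rho> * K / real t)"
      by (intro mult_left_mono) auto
    also have "\<dots> = - (2 / (real t + 1)) * h t - 2 / (real t + 1) * r + 2 / (real t + 1) * (\<rho> * K / real t)"
      by (simp only: algebra_simps)
    finally show ?thesis
      using descent[OF t y] unfolding h_def by (simp add: left_diff_distrib)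
  qed
  have "h t \<le> (8 * (\<rho> * K) + 2 * (L * \<rho>\<^sup>2)) / (real t + 1)" if "t \<ge> 2" for t
    using progress[OF _ star(1), of _ 0] \<rho> K L that
    by (intro sublinear_recursion) auto
  moreover have "h t \<le> (4 * (\<rho> * K) + L * \<rho>\<^sup>2)\<^sup>2 / (2 * \<delta>\<^sup>2 * \<mu>) * (9 / (real t + 1)\<^sup>2)"
    if "\<mu> > 0" and sc: "strongly_convex \<mu> F" and int: "\<theta>star \<in> interior C" and "t \<ge> 1" for t \<mu>
  proof -
    note \<delta> = cball_infdist_frontier_subset[OF assms(5) bdd int, folded \<delta>_def \<rho>_def]
    \<comment> \<open>Chosen so that
      \<open>\<delta> * sqrt (2 * \<mu> * h t) = q * sqrt (h t)\<close>.\<close>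
    define q where "q = \<delta> * sqrt (2 * \<mu>)"
    have q2: "q\<^sup>2 = 2 * \<delta>\<^sup>2 * \<mu>"
      using \<open>\<mu> > 0\<close> by (simp add: q_def power_mult_distrib)
    \<comment> \<open>From \<open>\<delta> \<le> \<rho>\<close> and \<open>\<mu> \<le> L\<close>; it
      supplies the link between \<open>q\<close> and the curvature constant that the recursion
      requires.\<close>
    have "\<delta>\<^sup>2 * \<mu> \<le> \<rho>\<^sup>2 * L"
      using strong_convexity_le_smoothness[OF sc smoothF] \<delta>(1,2) \<open>\<mu> > 0\<close>
      by (intro mult_mono power_mono) auto
    then have qL: "q\<^sup>2 \<le> 2 * (L * \<rho>\<^sup>2)"
      unfolding q2 by (simp add: mult.commute)
    have "F differentiable (at \<theta>star)"
      using GDERIV_average[of N f \<theta>star] diff unfolding F_def gderiv_def differentiable_def by blast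
    then have "grad F \<theta>star = 0"
      using assms(16) int by (rule grad_eq_0_at_interior_min)
    \<comment> \<open>Smoothness based at \<open>\<theta>star\<close>, where the gradient vanishes,
      bounds the initial gap; hence this rate can start at 1.\<close>
    then have "h 1 \<le> L / 2 * (norm (x 1 - \<theta>star))\<^sup>2"
      using smoothF unfolding smooth_def h_def by (metis add_0 inner_zero_left)
    also have "\<dots> \<le> L / 2 * \<rho>\<^sup>2"
      using diameter_bounded_bound[OF bdd xC[of 1] star(1)] L unfolding \<rho>_def
      by (intro mult_left_mono power_mono) (auto simp: dist_norm)
    finally have h1: "h 1 \<le> (L * \<rho>\<^sup>2) / 2"
      by simp
    have strong_step: "h (t + 1) \<le> (1 - 2 / (real t + 1)) * h t - 2 / (real t + 1) * (q * sqrt (h t))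
      + (2 / (real t + 1) * (\<rho> * K / real t) + (2 / (real t + 1))\<^sup>2 * (L * \<rho>\<^sup>2) / 2)"
      if t: "t \<ge> 1" for t
    proof (rule progress[OF t])
      let ?g = "grad F (x t)"
      \<comment> \<open>As \<open>sgn 0 = 0\<close>, a vanishing gradient gives
        \<open>\<theta>star\<close> itself and needs no separate argument.\<close>
      show "\<theta>star - \<delta> *\<^sub>R sgn ?g \<in> C"
        using \<delta>(1) by (intro subsetD[OF \<delta>(3)]) (simp add: dist_norm norm_sgn)
      have "sqrt (2 * \<mu> * h t) \<le> norm ?g"
        using strongly_convex_gradient_dominates[OF sc \<open>\<mu> > 0\<close>, of "x t" \<theta>star]
        unfolding h_def by (intro real_le_lsqrt) auto
      then have "q * sqrt (h t) \<le> \<delta> * norm ?g"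
        using \<delta>(1) unfolding q_def by (simp add: real_sqrt_mult mult.assoc)
      also have "norm ?g = inner ?g (sgn ?g)"
        by (cases "?g = 0") (simp_all add: sgn_div_norm dot_square_norm power2_eq_square)
      finally show "inner ?g (\<theta>star - \<delta> *\<^sub>R sgn ?g - \<theta>star) \<le> - (q * sqrt (h t))"
        by simp
    qed
    show ?thesis
      unfolding q2[symmetric] using \<rho> K L \<delta>(1) \<open>\<mu> > 0\<close> qL h0 h1 strong_step \<open>t \<ge> 1\<close>
      by (intro quadratic_recursion) (auto simp: q_def)
  qed
  ultimately show ?thesis
    unfolding h_def x_def K_def by (simp add: mult.assoc)
qed

end
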